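(* Let $P\subseteq\mathbb{R}^d$ be a full-dimensional convex polytope with $0\in P$. Then the intersection body $IP$ of $P$ is a semialgebraic subset of $\mathbb{R}^d$.
   Context: For a convex body (nonempty compact convex set) $K\subset\mathbb{R}^d$, its intersection body is defined via its radial function: for $x\in\mathbb{R}^d\setminus\{0\}$ set $\rho_{IK}(x)=\frac{1}{\|x\|}\operatorname{Vol}_{d-1}(K\cap x^\perp)$, where $x^\perp=\{y:\langle x,y\rangle=0\}$ and $\operatorname{Vol}_{d-1}$ is $(d-1)$-dimensional Euclidean volume, and $IK=\{x\in\mathbb{R}^d\setminus\{0\}:\rho_{IK}(x)\ge 1\}\cup\{0\}$. A set is semialgebraic if it is a finite Boolean combination of sets defined by polynomial inequalities with real coefficients. *)

theory Defs
  imports "HOL-Analysis.Analysis"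
begin

inductive polyfun :: "(real^'n \<Rightarrow> real) \<Rightarrow> bool" where
  const: "polyfun (\<lambda>x. c)"
| coord: "polyfun (\<lambda>x. x $ i)"
| add: "polyfun p \<Longrightarrow> polyfun q \<Longrightarrow> polyfun (\<lambda>x. p x + q x)"
| mult: "polyfun p \<Longrightarrow> polyfun q \<Longrightarrow> polyfun (\<lambda>x. p x * q x)"

inductive semialgebraic :: "(real^'n) set \<Rightarrow> bool" where
  basic_ge: "polyfun p \<Longrightarrow> semialgebraic {x. p x \<ge> 0}"
| basic_gt: "polyfun p \<Longrightarrow> semialgebraic {x. p x > 0}"
| union: "semialgebraic A \<Longrightarrow> semialgebraic B \<Longrightarrow> semialgebraic (A \<union> B)"
| inter: "semialgebraic A \<Longrightarrow> semialgebraic B \<Longrightarrow> semialgebraic (A \<inter> B)"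
| compl: "semialgebraic A \<Longrightarrow> semialgebraic (- A)"

definition orth_hyperplane :: "real^'n \<Rightarrow> (real^'n) set" where
  "orth_hyperplane x = {y. x \<bullet> y = 0}"

text \<open>(d-1)-dimensional volume of a set \<open>S\<close> lying in the hyperplane \<open>x\<^sup>\<perp>\<close>
  (x \<noteq> 0): the d-dimensional Lebesgue volume of the right prism of height 1
  over \<open>S\<close> in direction of the unit normal \<open>x / \<parallel>x\<parallel>\<close> (Cavalieri).\<close>
definition hyperplane_volume :: "real^'n \<Rightarrow> (real^'n) set \<Rightarrow> real" where
  "hyperplane_volume x S =
     measure lebesgue {s + t *\<^sub>R (x /\<^sub>R norm x) | s t. s \<in> S \<and> t \<in> {0..1}}"

definition radial_IB :: "(real^'n) set \<Rightarrow> real^'n \<Rightarrow> real" where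
  "radial_IB K x = hyperplane_volume x (K \<inter> orth_hyperplane x) / norm x"

definition intersection_body :: "(real^'n) set \<Rightarrow> (real^'n) set" where
  "intersection_body K = {x. x \<noteq> 0 \<and> radial_IB K x \<ge> 1} \<union> {0}"

end

theory Submission
  imports Defs
begin

text \<open>
  For \<open>x \<noteq> 0\<close> the prism \<open>Q x = {s + t x | s \<in> P \<inter> x\<^sup>\<perp>, 0 \<le> t \<le> 1}\<close> has volume
  \<open>V x = \<parallel>x\<parallel>\<^sup>2 \<rho> x\<close>, where \<open>\<rho>\<close> is the radial function of the intersection body, so the condition
  \<open>\<rho> x \<ge> 1\<close> reads \<open>V x \<ge> x \<bullet> x\<close> and no square root is left. Multiplying the inequalities of \<open>P\<close>
  at the orthogonal projection of \<open>w\<close> by \<open>x \<bullet> x\<close> describes \<open>w \<in> Q x\<close> by inequalities that are affine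
  in \<open>w\<close> with coefficients polynomial in \<open>x\<close>. The indicator of \<open>Q x\<close> is integrated one coordinate of
  \<open>w\<close> at a time. Consider functions that are piecewise polynomial in \<open>w\<close>, with pieces cut out by affine
  inequalities in \<open>w\<close> and all coefficients piecewise rational in \<open>x\<close>. Integration in one coordinate
  between affine bounds preserves this class: an affine condition either does not involve the
  coordinate or compares it with a threshold that is again affine in the others. Hence \<open>V\<close> is
  piecewise rational on semialgebraic pieces.
\<close>

section \<open>Piecewise rational functions\<close>

lemma polyfun_sum: "(\<And>i. i \<in> I \<Longrightarrow> polyfun (p i)) \<Longrightarrow> polyfun (\<lambda>x. \<Sum>i\<in>I. p i x)"
  by (induction I rule: infinite_finite_induct) (auto intro: polyfun.intros)

lemma polyfun_minus: "polyfun p \<Longrightarrow> polyfun (\<lambda>x. - p x)"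
  using polyfun.mult[OF polyfun.const[of "-1"]] by simp

lemma polyfun_inner: "polyfun (\<lambda>x. x \<bullet> v)"
  unfolding inner_vec_def inner_real_def
  by (intro polyfun_sum polyfun.mult polyfun.coord polyfun.const)

lemma polyfun_inner_self: "polyfun (\<lambda>x. x \<bullet> x)"
  unfolding inner_vec_def inner_real_def
  by (intro polyfun_sum polyfun.mult polyfun.coord)

lemma semialgebraic_zero_set:
  assumes "polyfun p"
  shows "semialgebraic {x. p x = 0}"
proof -
  have "{x. p x = 0} = {x. p x \<ge> 0} \<inter> {x. - p x \<ge> 0}" by auto
  then show ?thesis
    using semialgebraic.inter[OF semialgebraic.basic_ge[OF assms]
        semialgebraic.basic_ge[OF polyfun_minus[OF assms]]] by simp
qed

text \<open>Thanks to \<open>p / 0 = 0\<close> this class is closed under inversion without a case distinction.\<close>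

inductive pwrat :: "(real^'n \<Rightarrow> real) \<Rightarrow> bool" where
  quotient: "polyfun p \<Longrightarrow> polyfun q \<Longrightarrow> pwrat (\<lambda>x. p x / q x)"
| glue: "semialgebraic A \<Longrightarrow> pwrat f \<Longrightarrow> pwrat g \<Longrightarrow> pwrat (\<lambda>x. if x \<in> A then f x else g x)"

lemma pwrat_polyfun: "polyfun p \<Longrightarrow> pwrat p"
  using pwrat.quotient[of p "\<lambda>_. 1"] by (simp add: polyfun.const)

lemma pwrat_const: "pwrat (\<lambda>x. c)"
  by (intro pwrat_polyfun polyfun.const)

text \<open>Closure under a binary operation takes two nested inductions. Here one operand is a
  plain quotient and the induction splits the other along its pieces; \<open>pwrat_add\<close> then
  splits the first.\<close>

lemma pwrat_add_quotient:
  assumes "pwrat g" "polyfun p" "polyfun q"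
  shows "pwrat (\<lambda>x. p x / q x + g x)"
  using assms(1)
proof induction
  case (quotient r s)
  \<comment> \<open>Since \<open>p / 0 = 0\<close>, a common denominator is valid only where neither
    \<open>q\<close> nor \<open>s\<close> vanishes; elsewhere the sum reduces to the other
    fraction.\<close>
  have *: "(\<lambda>x. p x / q x + r x / s x) =
    (\<lambda>x. if x \<in> {x. q x = 0} then r x / s x else if x \<in> {x. s x = 0} then p x / q x
          else (p x * s x + r x * q x) / (q x * s x))"
    by (auto simp: fun_eq_iff field_simps)
  show ?case
    unfolding * using assms quotient
    by (intro pwrat.intros semialgebraic_zero_set polyfun.add polyfun.mult) auto
next
  case (glue A f g)
  have *: "(\<lambda>x. p x / q x + (if x \<in> A then f x else g x)) =
     (\<lambda>x. if x \<in> A then p x / q x + f x else p x / q x + g x)" by auto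
  show ?case unfolding * using glue by (intro pwrat.glue)
qed

lemma pwrat_add:
  assumes "pwrat f" "pwrat g"
  shows "pwrat (\<lambda>x. f x + g x)"
  using assms(1)
proof induction
  case (quotient p q)
  then show ?case using assms(2) pwrat_add_quotient by blast
next
  case (glue A f h)
  have *: "(\<lambda>x. (if x \<in> A then f x else h x) + g x) =
     (\<lambda>x. if x \<in> A then f x + g x else h x + g x)" by auto
  show ?case unfolding * using glue by (intro pwrat.glue)
qed

lemma pwrat_mult_quotient:
  assumes "pwrat g" "polyfun p" "polyfun q"
  shows "pwrat (\<lambda>x. p x / q x * g x)"
  using assms(1)
proof induction
  case (quotient r s)
  \<comment> \<open>Unlike for sums, no case distinction arises: if \<open>q\<close> or
    \<open>s\<close> vanishes, both sides are 0.\<close>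
  have "pwrat (\<lambda>x. (p x * r x) / (q x * s x))"
    using assms quotient by (intro pwrat.intros polyfun.mult)
  then show ?case by simp
next
  case (glue A f g)
  have *: "(\<lambda>x. p x / q x * (if x \<in> A then f x else g x)) =
     (\<lambda>x. if x \<in> A then p x / q x * f x else p x / q x * g x)" by auto
  show ?case unfolding * using glue by (intro pwrat.glue)
qed

lemma pwrat_mult:
  assumes "pwrat f" "pwrat g"
  shows "pwrat (\<lambda>x. f x * g x)"
  using assms(1)
proof induction
  case (quotient p q)
  then show ?case using assms(2) pwrat_mult_quotient by blast
next
  case (glue A f h)
  have *: "(\<lambda>x. (if x \<in> A then f x else h x) * g x) =
     (\<lambda>x. if x \<in> A then f x * g x else h x * g x)" by auto
  show ?case unfolding * using glue by (intro pwrat.glue)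
qed

lemma pwrat_minus: "pwrat f \<Longrightarrow> pwrat (\<lambda>x. - f x)"
  using pwrat_mult[OF pwrat_const[of "-1"]] by simp

lemma pwrat_inverse:
  assumes "pwrat f"
  shows "pwrat (\<lambda>x. inverse (f x))"
  using assms
proof induction
  case (quotient p q)
  then show ?case by (simp add: pwrat.quotient)
next
  case (glue A f h)
  have *: "(\<lambda>x. inverse (if x \<in> A then f x else h x)) =
     (\<lambda>x. if x \<in> A then inverse (f x) else inverse (h x))" by auto
  show ?case unfolding * using glue by (intro pwrat.glue)
qed

text \<open>A quotient has the same sign as the product of numerator and denominator; for
  denominator 0 both are 0. This turns rational conditions into polynomial ones.\<close>

lemma semialgebraic_pwrat_gt:
  assumes "pwrat f"
  shows "semialgebraic {x. f x > 0}"
  using assms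
proof induction
  case (quotient p q)
  have "{x. p x / q x > 0} = {x. p x * q x > 0}"
    by (auto simp: zero_less_divide_iff zero_less_mult_iff)
  with quotient show ?case by (simp add: semialgebraic.intros polyfun.mult)
next
  case (glue A f g)
  have "{x. (if x \<in> A then f x else g x) > 0} =
    (A \<inter> {x. f x > 0}) \<union> (- A \<inter> {x. g x > 0})" by auto
  with glue show ?case by (simp add: semialgebraic.intros)
qed

lemma semialgebraic_pwrat_ge:
  assumes "pwrat f"
  shows "semialgebraic {x. f x \<ge> 0}"
proof -
  have "{x. f x \<ge> 0} = - {x. - f x > 0}" by auto
  then show ?thesis
    using semialgebraic.compl[OF semialgebraic_pwrat_gt[OF pwrat_minus[OF assms]]] by simp
qed

section \<open>Piecewise polynomial functions with parameters\<close>

text \<open>Throughout, the first argument is the parameter and the second one the variable.\<close>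

inductive param_affine :: "(real^'n \<Rightarrow> ('i \<Rightarrow> real) \<Rightarrow> real) \<Rightarrow> bool" where
  const: "pwrat c \<Longrightarrow> param_affine (\<lambda>x y. c x)"
| coord: "pwrat c \<Longrightarrow> param_affine (\<lambda>x y. c x * y i)"
| add: "param_affine L \<Longrightarrow> param_affine M \<Longrightarrow> param_affine (\<lambda>x y. L x y + M x y)"

lemma param_affine_scale:
  assumes "param_affine L" "pwrat c"
  shows "param_affine (\<lambda>x y. c x * L x y)"
  using assms(1)
proof induction
  case (const d)
  then show ?case using assms(2) by (intro param_affine.const pwrat_mult)
next
  case (coord d i)
  have "param_affine (\<lambda>x y. (c x * d x) * y i)"
    using assms(2) coord by (intro param_affine.coord pwrat_mult)
  then show ?case by (simp add: mult.assoc)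
next
  case (add L M)
  then show ?case by (simp add: distrib_left param_affine.add)
qed

lemma param_affine_diff:
  assumes "param_affine L" "param_affine M"
  shows "param_affine (\<lambda>x y. L x y - M x y)"
  using param_affine.add[OF assms(1) param_affine_scale[OF assms(2) pwrat_const[of "-1"]]] by simp

lemma param_affine_sum:
  "(\<And>b. b \<in> B \<Longrightarrow> param_affine (L b)) \<Longrightarrow> param_affine (\<lambda>x y. \<Sum>b\<in>B. L b x y)"
  by (induction B rule: infinite_finite_induct)
    (auto intro: param_affine.add param_affine.const pwrat_const)

text \<open>Singles out the coordinate to be integrated. The slope \<open>c\<close> depends on the
  parameter alone, so where it is nonzero the sign changes at \<open>t = - M / c\<close>, which is
  again affine in the variable because \<open>inverse c\<close> is piecewise rational.\<close>

lemma param_affine_update: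
  assumes "param_affine L"
  obtains c M where "pwrat c" "param_affine M" "\<And>x y t. L x (y(i := t)) = c x * t + M x y"
proof -
  have "\<exists>c M. pwrat c \<and> param_affine M \<and> (\<forall>x y t. L x (y(i := t)) = c x * t + M x y)"
    using assms
  proof induction
    case (const d)
    then show ?case
      by (intro exI[of _ "\<lambda>x. 0"] exI[of _ "\<lambda>x y. d x"])
        (auto intro: pwrat_const param_affine.const)
  next
    case (coord d j)
    show ?case
    proof (cases "i = j")
      case True
      with coord show ?thesis
        by (intro exI[of _ d] exI[of _ "\<lambda>x y. 0"])
          (auto intro: pwrat_const param_affine.const)
    next
      case False
      with coord show ?thesis
        by (intro exI[of _ "\<lambda>x. 0"] exI[of _ "\<lambda>x y. d x * y j"])
          (auto intro: pwrat_const param_affine.coord)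
    qed
  next
    case (add L M)
    then obtain c L' d M' where *: "pwrat c" "param_affine L'" "pwrat d" "param_affine M'"
      "\<forall>x y t. L x (y(i := t)) = c x * t + L' x y"
      "\<forall>x y t. M x (y(i := t)) = d x * t + M' x y" by metis
    then show ?case
      by (intro exI[of _ "\<lambda>x. c x + d x"] exI[of _ "\<lambda>x y. L' x y + M' x y"])
        (auto intro: pwrat_add param_affine.add simp: algebra_simps simp del: fun_upd_apply)
  qed
  then show thesis using that by blast
qed

section \<open>Polynomials in the variable\<close>

inductive param_poly :: "(real^'n \<Rightarrow> ('i \<Rightarrow> real) \<Rightarrow> real) \<Rightarrow> bool" where
  const: "pwrat c \<Longrightarrow> param_poly (\<lambda>x y. c x)"
| coord: "param_poly (\<lambda>x y. y i)"
| add: "param_poly F \<Longrightarrow> param_poly G \<Longrightarrow> param_poly (\<lambda>x y. F x y + G x y)"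
| mult: "param_poly F \<Longrightarrow> param_poly G \<Longrightarrow> param_poly (\<lambda>x y. F x y * G x y)"

lemma param_poly_affine: "param_affine L \<Longrightarrow> param_poly L"
  by (induction rule: param_affine.induct) (auto intro: param_poly.intros)

lemma param_poly_real: "param_poly (\<lambda>x y. r)"
  by (intro param_poly.const pwrat_const)

lemma param_poly_sum:
  "(\<And>k. k \<in> K \<Longrightarrow> param_poly (F k)) \<Longrightarrow> param_poly (\<lambda>x y. \<Sum>k\<in>K. F k x y)"
  by (induction K rule: infinite_finite_induct) (auto intro: param_poly.add param_poly_real)

lemma param_poly_power: "param_poly F \<Longrightarrow> param_poly (\<lambda>x y. F x y ^ k)"
  by (induction k) (auto intro: param_poly.mult param_poly_real)

lemma param_poly_diff:
  assumes "param_poly F" "param_poly G"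
  shows "param_poly (\<lambda>x y. F x y - G x y)"
  using param_poly.add[OF assms(1) param_poly.mult[OF param_poly_real[of "-1"] assms(2)]] by simp

lemma param_poly_update:
  assumes "param_poly F"
  obtains n a where "\<And>k. param_poly (a k)"
    "\<And>x y t. F x (y(i := t)) = (\<Sum>k\<le>n. a k x y * t ^ k)"
proof -
  \<comment> \<open>Carrying a univariate polynomial through the induction lets products be handled
    by the convolution formula for \<open>coeff\<close>. Its degree may drop at special points, so
    only a bound uniform in \<open>x\<close> and \<open>y\<close> is kept.\<close>
  have "\<exists>n p. (\<forall>k. param_poly (\<lambda>x y. coeff (p x y) k)) \<and>
      (\<forall>x y. degree (p x y) \<le> n) \<and> (\<forall>x y t. F x (y(i := t)) = poly (p x y) t)"
    using assms
  proof induction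
    case (const c)
    have "param_poly (\<lambda>x y. coeff [:c x:] k)" for k
      by (cases k) (auto intro: param_poly.const param_poly_real const)
    then show ?case
      by (intro exI[of _ 0] exI[of _ "\<lambda>x y. [:c x:]"]) auto
  next
    case (coord j)
    show ?case
    proof (cases "i = j")
      case True
      then show ?thesis
        by (intro exI[of _ 1] exI[of _ "\<lambda>x y. [:0, 1:]"]) (auto intro: param_poly_real)
    next
      case False
      have "param_poly (\<lambda>x y. coeff [:y j:] k)" for k
        by (cases k) (auto intro: param_poly.coord param_poly_real)
      with False show ?thesis
        by (intro exI[of _ 0] exI[of _ "\<lambda>x y. [:y j:]"]) auto
    qed
  next
    case (add F G)
    then obtain n p m q where *: "\<forall>k. param_poly (\<lambda>x y. coeff (p x y) k)"
      "\<forall>x y. degree (p x y) \<le> n" "\<forall>x y t. F x (y(i := t)) = poly (p x y) t"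
      "\<forall>k. param_poly (\<lambda>x y. coeff (q x y) k)"
      "\<forall>x y. degree (q x y) \<le> m" "\<forall>x y t. G x (y(i := t)) = poly (q x y) t"
      by metis
    have "degree (p x y + q x y) \<le> max n m" for x y
      using * by (meson degree_add_le max.coboundedI1 max.coboundedI2)
    with * show ?case
      by (intro exI[of _ "max n m"] exI[of _ "\<lambda>x y. p x y + q x y"])
        (auto intro: param_poly.add simp del: fun_upd_apply)
  next
    case (mult F G)
    then obtain n p m q where *: "\<forall>k. param_poly (\<lambda>x y. coeff (p x y) k)"
      "\<forall>x y. degree (p x y) \<le> n" "\<forall>x y t. F x (y(i := t)) = poly (p x y) t"
      "\<forall>k. param_poly (\<lambda>x y. coeff (q x y) k)"
      "\<forall>x y. degree (q x y) \<le> m" "\<forall>x y t. G x (y(i := t)) = poly (q x y) t"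
      by metis
    have "degree (p x y * q x y) \<le> n + m" for x y
      using degree_mult_le[of "p x y" "q x y"] * by (meson add_mono order_trans)
    moreover have "param_poly (\<lambda>x y. coeff (p x y * q x y) k)" for k
      unfolding coeff_mult by (rule param_poly_sum, rule param_poly.mult) (use * in auto)
    ultimately show ?case
      using *(3,6) by (intro exI[of _ "n + m"] exI[of _ "\<lambda>x y. p x y * q x y"])
        (auto simp del: fun_upd_apply)
  qed
  then obtain n p where p: "\<forall>k. param_poly (\<lambda>x y. coeff (p x y) k)"
    "\<forall>x y. degree (p x y) \<le> n" "\<forall>x y t. F x (y(i := t)) = poly (p x y) t" by blast
  show thesis
  proof (rule that[of "\<lambda>k x y. coeff (p x y) k" n])
    show "F x (y(i := t)) = (\<Sum>k\<le>n. coeff (p x y) k * t ^ k)" for x y t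
    proof -
      have "poly (p x y) t = (\<Sum>k\<le>degree (p x y). coeff (p x y) k * t ^ k)"
        by (rule poly_altdef)
      also have "\<dots> = (\<Sum>k\<le>n. coeff (p x y) k * t ^ k)"
        by (rule sum.mono_neutral_left) (use p(2) in \<open>auto simp: coeff_eq_0\<close>)
      finally show ?thesis using p(3) by simp
    qed
  qed (use p in auto)
qed

text \<open>A decision tree with affine tests at the nodes and polynomials at the leaves. Only
  strict tests occur; a condition \<open>L x y \<le> 0\<close> is an else branch.\<close>

inductive param_pwpoly :: "(real^'n \<Rightarrow> ('i \<Rightarrow> real) \<Rightarrow> real) \<Rightarrow> bool" where
  leaf: "param_poly F \<Longrightarrow> param_pwpoly F"
| node: "param_affine L \<Longrightarrow> param_pwpoly F \<Longrightarrow> param_pwpoly G \<Longrightarrow>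
    param_pwpoly (\<lambda>x y. if L x y > 0 then F x y else G x y)"

lemma param_pwpoly_add_poly:
  assumes "param_pwpoly G" "param_poly F"
  shows "param_pwpoly (\<lambda>x y. F x y + G x y)"
  using assms(1)
proof induction
  case (leaf H)
  then show ?case using assms(2) by (intro param_pwpoly.leaf param_poly.add)
next
  case (node L H G)
  have *: "(\<lambda>x y. F x y + (if L x y > 0 then H x y else G x y)) =
    (\<lambda>x y. if L x y > 0 then F x y + H x y else F x y + G x y)" by (auto simp: fun_eq_iff)
  show ?case unfolding * using node by (intro param_pwpoly.node)
qed

lemma param_pwpoly_add:
  assumes "param_pwpoly F" "param_pwpoly G"
  shows "param_pwpoly (\<lambda>x y. F x y + G x y)"
  using assms(1)
proof induction
  case (leaf H)
  then show ?case using assms(2) param_pwpoly_add_poly by blast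
next
  case (node L F H)
  have *: "(\<lambda>x y. (if L x y > 0 then F x y else H x y) + G x y) =
    (\<lambda>x y. if L x y > 0 then F x y + G x y else H x y + G x y)" by (auto simp: fun_eq_iff)
  show ?case unfolding * using node by (intro param_pwpoly.node)
qed

lemma pwrat_param_poly: "param_poly F \<Longrightarrow> pwrat (\<lambda>x. F x y)"
  by (induction rule: param_poly.induct) (auto intro: pwrat_const pwrat_add pwrat_mult)

text \<open>With the variable fixed, every test becomes a semialgebraic condition on the parameter.
  This makes the volume piecewise rational once all coordinates are integrated out.\<close>

lemma pwrat_param_pwpoly:
  assumes "param_pwpoly F"
  shows "pwrat (\<lambda>x. F x y)"
  using assms
proof induction
  case (node L F G)
  have "semialgebraic {x. L x y > 0}"
    using semialgebraic_pwrat_gt[OF pwrat_param_poly[OF param_poly_affine[OF node.hyps(1)]]] .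
  from pwrat.glue[OF this node.IH] show ?case by simp
next
  case (leaf F)
  then show ?case by (rule pwrat_param_poly)
qed

text \<open>In this and the next two lemmas \<open>g\<close> is any coordinatewise measurable family
  of valuations, so that one updated coordinate, a product space and the coordinates of a vector are
  all covered.\<close>

lemma param_affine_measurable:
  "param_affine L \<Longrightarrow> (\<And>j. (\<lambda>z. g z j) \<in> borel_measurable N) \<Longrightarrow>
    (\<lambda>z. L x (g z)) \<in> borel_measurable N"
  by (induction rule: param_affine.induct) auto

lemma param_poly_measurable:
  "param_poly L \<Longrightarrow> (\<And>j. (\<lambda>z. g z j) \<in> borel_measurable N) \<Longrightarrow>
    (\<lambda>z. L x (g z)) \<in> borel_measurable N"
  by (induction rule: param_poly.induct) auto

lemma param_pwpoly_measurable:
  assumes "param_pwpoly F" and g: "\<And>j. (\<lambda>z. g z j) \<in> borel_measurable N"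
  shows "(\<lambda>z. F x (g z)) \<in> borel_measurable N"
  using assms(1)
proof induction
  case (node L F G)
  show ?case
    by (rule measurable_If[OF node.IH
          borel_measurable_less[OF borel_measurable_const param_affine_measurable[OF node.hyps(1) g]]])
qed (rule param_poly_measurable[OF _ g])

section \<open>Integration in one variable\<close>

text \<open>The value of \<open>h\<close> at \<open>m\<close> is left open, as a single point does
  not change an integral.\<close>

lemma has_integral_threshold:
  fixes f g :: "real \<Rightarrow> real"
  assumes "l \<le> m" "m \<le> u" "(f has_integral I) {l..m}" "(g has_integral J) {m..u}"
    and "\<And>t. t < m \<Longrightarrow> h t = f t" "\<And>t. t > m \<Longrightarrow> h t = g t"
  shows "(h has_integral I + J) {l..u}"
proof (rule has_integral_combine[OF assms(1,2)])
  show "(h has_integral I) {l..m}"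
    by (rule has_integral_spike_finite[OF _ _ assms(3), of "{m}"]) (use assms(5) in auto)
  show "(h has_integral J) {m..u}"
    by (rule has_integral_spike_finite[OF _ _ assms(4), of "{m}"]) (use assms(6) in auto)
qed

lemma has_integral_spike_endpoints:
  fixes f :: "real \<Rightarrow> real"
  assumes "(f has_integral I) {l..u}" "\<And>t. l < t \<Longrightarrow> t < u \<Longrightarrow> h t = f t"
  shows "(h has_integral I) {l..u}"
  by (rule has_integral_spike_finite[OF _ _ assms(1), of "{l, u}"]) (use assms(2) in auto)

text \<open>The closed form is polynomial in the coefficients and both endpoints, hence integrating
  a leaf between affine bounds gives a leaf.\<close>

lemma has_integral_powers:
  fixes l u :: real
  assumes "l \<le> u"
  shows "((\<lambda>t. \<Sum>k\<le>n. a k * t ^ k) has_integral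
     (\<Sum>k\<le>n. a k * (inverse (real (Suc k)) * (u ^ Suc k - l ^ Suc k)))) {l..u}"
proof (intro has_integral_sum has_integral_mult_right)
  fix k
  have "((\<lambda>t. t ^ k) has_integral
      (u ^ Suc k * inverse (real (Suc k)) - l ^ Suc k * inverse (real (Suc k)))) {l..u}"
  proof (rule fundamental_theorem_of_calculus[OF assms])
    fix t
    have "((\<lambda>t. t ^ Suc k * inverse (real (Suc k))) has_real_derivative
        real (Suc k) * t ^ k * inverse (real (Suc k))) (at t within {l..u})"
      by (intro DERIV_cmult_right) (use DERIV_pow[of "Suc k" t "{l..u}"] in simp)
    then show "((\<lambda>t. t ^ Suc k * inverse (real (Suc k))) has_vector_derivative t ^ k)
        (at t within {l..u})"
      by (simp add: has_real_derivative_iff_has_vector_derivative field_simps del: power_Suc of_nat_Suc)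
  qed
  then show "((\<lambda>t. t ^ k) has_integral (inverse (real (Suc k)) * (u ^ Suc k - l ^ Suc k))) {l..u}"
    by (simp add: algebra_simps)
qed auto

text \<open>Induction on the decision tree. The bounds are generalized because a node also
  integrates its branches over the two parts into which its threshold cuts the interval.\<close>

lemma param_pwpoly_integral:
  assumes "param_pwpoly F" "param_affine l" "param_affine u"
  shows "\<exists>T. param_pwpoly T \<and> (\<forall>x y. l x y \<le> u x y \<longrightarrow>
     ((\<lambda>t. F x (y(i := t))) has_integral T x y) {l x y..u x y})"
  using assms
proof (induction arbitrary: l u)
  case (leaf F)
  obtain n a where a: "\<And>k. param_poly (a k)"
    "\<And>x y t. F x (y(i := t)) = (\<Sum>k\<le>n. a k x y * t ^ k)"
    using param_poly_update[OF leaf(1), of i] by metis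
  define T where "T = (\<lambda>x y. \<Sum>k\<le>n. a k x y *
     (inverse (real (Suc k)) * (u x y ^ Suc k - l x y ^ Suc k)))"
  have "param_poly T"
    unfolding T_def
    by (rule param_poly_sum param_poly.mult a(1) param_poly_real param_poly_diff param_poly_power
        leaf.prems[THEN param_poly_affine])+
  then have "param_pwpoly T" by (rule param_pwpoly.leaf)
  moreover have "((\<lambda>t. F x (y(i := t))) has_integral T x y) {l x y..u x y}"
    if "l x y \<le> u x y" for x y
    unfolding a(2) T_def by (rule has_integral_powers[OF that])
  ultimately show ?case by blast
next
  case (node L F G)
  obtain c M where c: "pwrat c" "param_affine M"
    and L: "\<And>x y t. L x (y(i := t)) = c x * t + M x y"
    using param_affine_update[OF node.hyps(1), of i] by metis
  \<comment> \<open>The zero in \<open>t\<close> of the node test. For \<open>c x = 0\<close> it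
    takes the default value 0, and \<open>T\<close> then decides by the sign of \<open>M\<close>
    alone.\<close>
  define m where "m = (\<lambda>x y. - inverse (c x) * M x y)"
  have m: "param_affine m"
    unfolding m_def by (intro param_affine_scale c pwrat_minus pwrat_inverse)
  obtain F1 where F1: "param_pwpoly F1" "\<And>x y. l x y \<le> u x y \<Longrightarrow>
     ((\<lambda>t. F x (y(i := t))) has_integral F1 x y) {l x y..u x y}"
    using node.IH(1)[OF node.prems] by blast
  obtain F2 where F2: "param_pwpoly F2" "\<And>x y. l x y \<le> m x y \<Longrightarrow>
     ((\<lambda>t. F x (y(i := t))) has_integral F2 x y) {l x y..m x y}"
    using node.IH(1)[OF node.prems(1) m] by blast
  obtain F3 where F3: "param_pwpoly F3" "\<And>x y. m x y \<le> u x y \<Longrightarrow>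
     ((\<lambda>t. F x (y(i := t))) has_integral F3 x y) {m x y..u x y}"
    using node.IH(1)[OF m node.prems(2)] by blast
  obtain G1 where G1: "param_pwpoly G1" "\<And>x y. l x y \<le> u x y \<Longrightarrow>
     ((\<lambda>t. G x (y(i := t))) has_integral G1 x y) {l x y..u x y}"
    using node.IH(2)[OF node.prems] by blast
  obtain G2 where G2: "param_pwpoly G2" "\<And>x y. l x y \<le> m x y \<Longrightarrow>
     ((\<lambda>t. G x (y(i := t))) has_integral G2 x y) {l x y..m x y}"
    using node.IH(2)[OF node.prems(1) m] by blast
  obtain G3 where G3: "param_pwpoly G3" "\<And>x y. m x y \<le> u x y \<Longrightarrow>
     ((\<lambda>t. G x (y(i := t))) has_integral G3 x y) {m x y..u x y}"
    using node.IH(2)[OF m node.prems(2)] by blast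
  \<comment> \<open>\<open>T\<close> tests whether the node condition holds above
    (\<open>c x > 0\<close>) or below the threshold, then whether the threshold lies inside the
    interval; one on the boundary counts as outside. All comparisons are affine in \<open>y\<close>,
    so \<open>T\<close> is again a decision tree.\<close>
  define T where "T = (\<lambda>x y.
     if c x > 0 then
       if m x y - l x y > 0 then
         if u x y - m x y > 0 then G2 x y + F3 x y else G1 x y
       else F1 x y
     else if - c x > 0 then
       if m x y - l x y > 0 then
         if u x y - m x y > 0 then F2 x y + G3 x y else F1 x y
       else G1 x y
     else if M x y > 0 then F1 x y else G1 x y)"
  have "param_pwpoly T"
    unfolding T_def
    by (rule param_pwpoly.node param_pwpoly_add param_affine.const pwrat_minus
        F1 F2 F3 G1 G2 G3 c m param_affine_diff[OF m node.prems(1)]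
        param_affine_diff[OF node.prems(2) m])+
  moreover have "((\<lambda>t. if L x (y(i := t)) > 0 then F x (y(i := t)) else G x (y(i := t)))
      has_integral T x y) {l x y..u x y}" if lu: "l x y \<le> u x y" for x y
  proof -
    consider "c x > 0" | "c x < 0" | "c x = 0" by linarith
    then show ?thesis
    proof cases
      case 1
      then have s: "L x (y(i := t)) > 0 \<longleftrightarrow> t > m x y" for t
        by (auto simp: L m_def field_simps)
      consider "m x y \<le> l x y" | "m x y > l x y" "m x y < u x y" | "m x y > l x y" "u x y \<le> m x y"
        by linarith
      then show ?thesis
      proof cases
        case a: 1
        with 1 have "T x y = F1 x y" by (simp add: T_def)
        then show ?thesis
          by (auto simp: s intro!: has_integral_spike_endpoints[OF F1(2)[OF lu]]
              simp del: fun_upd_apply) (use a in linarith)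
      next
        case a: 2
        with 1 have T: "T x y = G2 x y + F3 x y" by (simp add: T_def)
        show ?thesis unfolding T s
          by (rule has_integral_threshold[OF _ _ G2(2) F3(2)]) (use a in auto)
      next
        case a: 3
        with 1 have "T x y = G1 x y" by (simp add: T_def)
        then show ?thesis
          by (auto simp: s intro!: has_integral_spike_endpoints[OF G1(2)[OF lu]]
              simp del: fun_upd_apply) (use a in linarith)
      qed
    next
      case 2
      then have s: "L x (y(i := t)) > 0 \<longleftrightarrow> t < m x y" for t
        by (auto simp: L m_def field_simps)
      consider "m x y \<le> l x y" | "m x y > l x y" "m x y < u x y" | "m x y > l x y" "u x y \<le> m x y"
        by linarith
      then show ?thesis
      proof cases
        case a: 1
        with 2 have "T x y = G1 x y" by (simp add: T_def)
        then show ?thesis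
          by (auto simp: s intro!: has_integral_spike_endpoints[OF G1(2)[OF lu]]
              simp del: fun_upd_apply) (use a in linarith)
      next
        case a: 2
        with 2 have T: "T x y = F2 x y + G3 x y" by (simp add: T_def)
        show ?thesis unfolding T s
          by (rule has_integral_threshold[OF _ _ F2(2) G3(2)]) (use a in auto)
      next
        case a: 3
        with 2 have "T x y = F1 x y" by (simp add: T_def)
        then show ?thesis
          by (auto simp: s intro!: has_integral_spike_endpoints[OF F1(2)[OF lu]]
              simp del: fun_upd_apply) (use a in linarith)
      qed
    next
      case 3
      then show ?thesis using F1(2)[OF lu] G1(2)[OF lu] by (simp add: L T_def)
    qed
  qed
  ultimately show ?case by blast
qed

text \<open>Passes from the gauge integral over an interval to the nonnegative Lebesgue integral
  over the line, the form used by Tonelli's theorem. The cutoff \<open>R\<close> depends on the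
  parameter only, so it supplies admissible affine bounds.\<close>

lemma param_pwpoly_nn_integral:
  assumes F: "param_pwpoly F" "\<And>x y. F x y \<ge> 0" and R: "pwrat R" "\<And>x. R x \<ge> 0"
  obtains T where "param_pwpoly T" "\<And>x y. T x y \<ge> 0"
    "\<And>x y. (\<integral>\<^sup>+t. (if \<bar>t\<bar> \<le> R x then ennreal (F x (y(i := t))) else 0) \<partial>lborel) = ennreal (T x y)"
proof -
  obtain T where T: "param_pwpoly T" "\<And>x y. - R x \<le> R x \<Longrightarrow>
     ((\<lambda>t. F x (y(i := t))) has_integral T x y) {- R x..R x}"
    using param_pwpoly_integral[OF F(1) param_affine.const[OF pwrat_minus[OF R(1)]]
        param_affine.const[OF R(1)], of i] by blast
  have I: "((\<lambda>t. F x (y(i := t))) has_integral T x y) {- R x..R x}" for x y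
    using T(2) R(2)[of x] by simp
  have meas: "(\<lambda>t. F x (y(i := t))) \<in> borel_measurable borel" for x y
    by (rule param_pwpoly_measurable[OF F(1)]) (simp add: fun_upd_def)
  have "(\<integral>\<^sup>+t. (if \<bar>t\<bar> \<le> R x then ennreal (F x (y(i := t))) else 0) \<partial>lborel) = ennreal (T x y)" for x y
  proof -
    let ?f = "\<lambda>t. if t \<in> {- R x..R x} then F x (y(i := t)) else 0"
    have "integral\<^sup>N lborel ?f = ennreal (T x y)"
    proof (rule nn_integral_has_integral_lborel)
      show "?f \<in> borel_measurable borel"
        by (rule measurable_If_set[OF meas]) auto
      show "(?f has_integral T x y) UNIV"
        unfolding has_integral_restrict_UNIV by (rule I)
    qed (use F(2) in auto)
    moreover have "(\<lambda>t. ennreal (?f t)) =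
        (\<lambda>t. if \<bar>t\<bar> \<le> R x then ennreal (F x (y(i := t))) else 0)"
      by (auto simp: fun_eq_iff simp del: fun_upd_apply)
    ultimately show ?thesis by simp
  qed
  moreover have "T x y \<ge> 0" for x y
    using has_integral_nonneg[OF I] F(2) by blast
  ultimately show thesis using that T(1) by blast
qed

section \<open>Volumes of parametrised polyhedra\<close>

interpretation lborel_prod: product_sigma_finite "\<lambda>_. lborel"
  by standard

text \<open>\<open>override_on\<close> separates the integrated coordinates, taken from
  \<open>z\<close>, from the free ones, taken from \<open>y\<close>. The result is of the same kind
  in \<open>y\<close>, so each new coordinate can be added as the outermost integral.\<close>

lemma param_pwpoly_box_integral:
  assumes "finite J" and F: "param_pwpoly F" "\<And>x y. F x y \<ge> 0" and R: "pwrat R" "\<And>x. R x \<ge> 0"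
  shows "\<exists>T. param_pwpoly T \<and> (\<forall>x y. T x y \<ge> 0 \<and>
    (\<integral>\<^sup>+z. (if \<forall>j\<in>J. \<bar>z j\<bar> \<le> R x then ennreal (F x (override_on y z J)) else 0)
      \<partial>PiM J (\<lambda>_. lborel)) = ennreal (T x y))"
  using assms(1)
proof (induction J)
  case empty
  then show ?case
    using F by (intro exI[of _ F]) (simp add: space_PiM PiM_empty)
next
  case (insert i J)
  then obtain T where T: "param_pwpoly T" "\<And>x y. T x y \<ge> 0"
    "\<And>x y. (\<integral>\<^sup>+z. (if \<forall>j\<in>J. \<bar>z j\<bar> \<le> R x then ennreal (F x (override_on y z J)) else 0)
      \<partial>PiM J (\<lambda>_. lborel)) = ennreal (T x y)" by blast
  obtain T' where T': "param_pwpoly T'" "\<And>x y. T' x y \<ge> 0"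
    "\<And>x y. (\<integral>\<^sup>+t. (if \<bar>t\<bar> \<le> R x then ennreal (T x (y(i := t))) else 0) \<partial>lborel) = ennreal (T' x y)"
    using param_pwpoly_nn_integral[OF T(1,2) R, of i] by blast
  have "(\<integral>\<^sup>+z. (if \<forall>j\<in>insert i J. \<bar>z j\<bar> \<le> R x
          then ennreal (F x (override_on y z (insert i J))) else 0)
      \<partial>PiM (insert i J) (\<lambda>_. lborel)) = ennreal (T' x y)" (is "integral\<^sup>N _ ?f = _") for x y
  proof -
    have "(\<lambda>z. F x (override_on y z (insert i J))) \<in> borel_measurable (PiM (insert i J) (\<lambda>_. lborel))"
    proof (rule param_pwpoly_measurable[OF F(1)])
      show "(\<lambda>z. override_on y z (insert i J) j) \<in> borel_measurable (PiM (insert i J) (\<lambda>_. lborel))" for j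
        by (cases "j \<in> insert i J") (simp_all add: override_on_def)
    qed
    then have "?f \<in> borel_measurable (PiM (insert i J) (\<lambda>_. lborel))"
    proof (rule measurable_If[OF measurable_compose[OF _ measurable_ennreal] measurable_const])
      show "{z \<in> space (PiM (insert i J) (\<lambda>_. lborel)). \<forall>j\<in>insert i J. \<bar>z j\<bar> \<le> R x}
          \<in> sets (PiM (insert i J) (\<lambda>_. lborel))"
      proof (rule sets.sets_Collect_finite_All)
        fix j assume j: "j \<in> insert i J"
        have "(\<lambda>z. z j) \<in> borel_measurable (PiM (insert i J) (\<lambda>_. lborel))"
          using measurable_component_singleton[OF j, of "\<lambda>_. lborel"] by simp
        then show "{z \<in> space (PiM (insert i J) (\<lambda>_. lborel)). \<bar>z j\<bar> \<le> R x}
            \<in> sets (PiM (insert i J) (\<lambda>_. lborel))"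
          by measurable
      qed (use insert.hyps in simp)
    qed simp
    then have "integral\<^sup>N (PiM (insert i J) (\<lambda>_. lborel)) ?f =
        (\<integral>\<^sup>+t. (\<integral>\<^sup>+z. ?f (z(i := t)) \<partial>PiM J (\<lambda>_. lborel)) \<partial>lborel)"
      using insert.hyps by (intro lborel_prod.product_nn_integral_insert_rev)
    also have "\<dots> = (\<integral>\<^sup>+t. (if \<bar>t\<bar> \<le> R x then ennreal (T x (y(i := t))) else 0) \<partial>lborel)"
    proof (rule nn_integral_cong)
      fix t
      \<comment> \<open>The new coordinate moves from the integration point into the free valuation,
        where the induction hypothesis applies.\<close>
      have "override_on y (z(i := t)) (insert i J) = override_on (y(i := t)) z J" for z
        using insert.hyps by (auto simp: override_on_def fun_eq_iff)
      moreover have "(\<forall>j\<in>insert i J. \<bar>(z(i := t)) j\<bar> \<le> R x) \<longleftrightarrow>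
          \<bar>t\<bar> \<le> R x \<and> (\<forall>j\<in>J. \<bar>z j\<bar> \<le> R x)" for z
        using insert.hyps by auto
      ultimately have "?f (z(i := t)) = (if \<bar>t\<bar> \<le> R x then
          if \<forall>j\<in>J. \<bar>z j\<bar> \<le> R x then ennreal (F x (override_on (y(i := t)) z J)) else 0 else 0)" for z
        by (simp del: fun_upd_apply)
      then show "(\<integral>\<^sup>+z. ?f (z(i := t)) \<partial>PiM J (\<lambda>_. lborel)) =
          (if \<bar>t\<bar> \<le> R x then ennreal (T x (y(i := t))) else 0)"
        by (cases "\<bar>t\<bar> \<le> R x")
          (simp_all only: T(3)[symmetric] if_True if_False nn_integral_const mult_zero_left)
    qed
    also have "\<dots> = ennreal (T' x y)" by (rule T'(3))
    finally show ?thesis .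
  qed
  with T' show ?case by blast
qed

lemma param_pwpoly_indicator:
  assumes "finite H" "\<And>L. L \<in> H \<Longrightarrow> param_affine L"
  shows "param_pwpoly (\<lambda>x y. if \<forall>L\<in>H. L x y \<le> 0 then 1 else 0)"
  using assms
proof (induction H)
  case empty
  then show ?case by (simp add: param_pwpoly.leaf param_poly_real)
next
  case (insert L H)
  have "(\<lambda>x y. if \<forall>L\<in>insert L H. L x y \<le> 0 then 1 else 0 :: real) =
    (\<lambda>x y. if L x y > 0 then 0 else if \<forall>L\<in>H. L x y \<le> 0 then 1 else 0)"
    by (auto simp: fun_eq_iff)
  then show ?case
    using param_pwpoly.node[OF _ param_pwpoly.leaf[OF param_poly_real[of 0]] insert.IH] insert.prems
    by simp
qed

text \<open>Coordinates are indexed by \<open>Basis\<close> vectors, with filler 0 at other indices,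
  to match Lebesgue measure as the image of a product measure over \<open>Basis\<close>. The formula
  is claimed where a cube of half-width \<open>R x\<close> contains \<open>Q x\<close>; elsewhere
  the construction measures only the part inside the cube.\<close>

lemma pwrat_volume_polyhedron:
  fixes H :: "(real^'n \<Rightarrow> (real^'n \<Rightarrow> real) \<Rightarrow> real) set" and R :: "real^'n \<Rightarrow> real"
  defines "Q \<equiv> \<lambda>x. {w. \<forall>L\<in>H. L x (override_on (\<lambda>_. 0) (\<lambda>b. w \<bullet> b) Basis) \<le> 0}"
  assumes H: "finite H" "\<And>L. L \<in> H \<Longrightarrow> param_affine L" and R: "pwrat R" "\<And>x. R x \<ge> 0"
  obtains V where "pwrat V"
    "\<And>x. (\<And>w b. w \<in> Q x \<Longrightarrow> b \<in> Basis \<Longrightarrow> \<bar>w \<bullet> b\<bar> \<le> R x) \<Longrightarrow> measure lebesgue (Q x) = V x"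
proof -
  let ?y0 = "\<lambda>_::real^'n. 0 :: real" and ?M = "PiM (Basis :: (real^'n) set) (\<lambda>_. lborel :: real measure)"
  let ?F = "\<lambda>x y. if \<forall>L\<in>H. L x y \<le> 0 then 1 else 0 :: real"
  obtain T where T: "param_pwpoly T" "\<And>x y. T x y \<ge> 0"
    "\<And>x y. (\<integral>\<^sup>+z. (if \<forall>j\<in>Basis. \<bar>z j\<bar> \<le> R x then ennreal (?F x (override_on y z Basis)) else 0)
      \<partial>?M) = ennreal (T x y)"
    using param_pwpoly_box_integral[OF finite_Basis param_pwpoly_indicator[OF H] _ R] by fastforce
  have "measure lebesgue (Q x) = T x ?y0"
    if box: "\<And>w b. w \<in> Q x \<Longrightarrow> b \<in> Basis \<Longrightarrow> \<bar>w \<bullet> b\<bar> \<le> R x" for x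
  proof -
    let ?w = "\<lambda>z. \<Sum>b\<in>Basis. z b *\<^sub>R b :: real^'n"
    have "{w \<in> space borel. L x (override_on ?y0 (\<lambda>b. w \<bullet> b) Basis) \<le> 0} \<in> sets borel" if "L \<in> H" for L
    proof (intro borel_measurable_le borel_measurable_const param_affine_measurable[OF H(2)[OF that]])
      show "(\<lambda>w. override_on ?y0 (\<lambda>b. w \<bullet> b) Basis j) \<in> borel_measurable borel" for j
        by (cases "j \<in> Basis") (simp_all add: override_on_def)
    qed
    then have Q: "Q x \<in> sets borel"
      using sets.sets_Collect_finite_All[OF _ H(1), of borel
          "\<lambda>L w. L x (override_on ?y0 (\<lambda>b. w \<bullet> b) Basis) \<le> 0"] by (simp add: Q_def)
    have "override_on ?y0 (\<lambda>b. ?w z \<bullet> b) Basis = override_on ?y0 z Basis" for z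
      by (auto simp: override_on_def fun_eq_iff inner_sum_left inner_Basis if_distrib cong: if_cong)
    then have mem: "?w z \<in> Q x \<longleftrightarrow> (\<forall>L\<in>H. L x (override_on ?y0 z Basis) \<le> 0)" for z
      by (simp add: Q_def)
    \<comment> \<open>By \<open>box\<close>, the cutoff removes nothing of
      \<open>Q x\<close>.\<close>
    have *: "indicator (Q x) (?w z) = (if \<forall>j\<in>Basis. \<bar>z j\<bar> \<le> R x
        then ennreal (?F x (override_on ?y0 z Basis)) else 0)" for z
    proof (cases "?w z \<in> Q x")
      case True
      then have "\<bar>z b\<bar> \<le> R x" if "b \<in> Basis" for b
        using box[OF True that] that
        by (simp add: inner_sum_left inner_Basis if_distrib cong: if_cong)
      with True show ?thesis by (simp add: mem)
    next
      case False
      then have "\<not> (\<forall>L\<in>H. L x (override_on ?y0 z Basis) \<le> 0)" by (simp add: mem)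
      with False show ?thesis by (simp only: if_False ennreal_0 if_cancel indicator_simps not_False_eq_True)
    qed
    have w: "?w \<in> ?M \<rightarrow>\<^sub>M borel" by measurable
    have "emeasure lborel (Q x) = (\<integral>\<^sup>+w. indicator (Q x) w \<partial>distr ?M borel ?w)"
      using Q by (simp flip: lborel_eq)
    also have "\<dots> = (\<integral>\<^sup>+z. indicator (Q x) (?w z) \<partial>?M)"
      using Q by (intro nn_integral_distr w) simp
    also have "\<dots> = ennreal (T x ?y0)"
      unfolding * by (rule T(3))
    finally show ?thesis
      using Q T(2) by (simp add: measure_def)
  qed
  moreover have "pwrat (\<lambda>x. T x ?y0)" by (rule pwrat_param_pwpoly[OF T(1)])
  ultimately show thesis using that by blast
qed

section \<open>Prisms over hyperplane sections\<close>

text \<open>Nonnegativity makes \<open>m\<close> monotone. Squeezing \<open>n * r\<close> between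
  consecutive integers bounds \<open>n\<close> times the defect \<open>m r - r * m 1\<close> by
  \<open>m 1\<close> for every \<open>n\<close>, so the defect is 0.\<close>

lemma additive_nonneg_imp_linear:
  fixes m :: "real \<Rightarrow> real"
  assumes add: "\<And>a b. a \<ge> 0 \<Longrightarrow> b \<ge> 0 \<Longrightarrow> m (a + b) = m a + m b"
    and nonneg: "\<And>a. a \<ge> 0 \<Longrightarrow> m a \<ge> 0" and "r \<ge> 0"
  shows "m r = r * m 1"
proof -
  have mono: "m a \<le> m b" if "0 \<le> a" "a \<le> b" for a b
    using add[of a "b - a"] nonneg[of "b - a"] that by simp
  have mult: "m (real n * a) = real n * m a" if "a \<ge> 0" for n a
  proof (induction n)
    case 0
    show ?case using add[of 0 0] by simp
  next
    case (Suc n)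
    then show ?case using add[of "real n * a" a] that by (simp add: algebra_simps)
  qed
  have bound: "\<bar>real n * (m r - r * m 1)\<bar> \<le> m 1" for n
  proof -
    define k where "k = nat \<lfloor>real n * r\<rfloor>"
    have k: "real k \<le> real n * r" "real n * r \<le> real (Suc k)"
      using \<open>r \<ge> 0\<close> unfolding k_def by (simp_all add: of_nat_nat) linarith
    have "real k * m 1 \<le> real n * m r" "real n * m r \<le> real (Suc k) * m 1"
      using mono[OF _ k(1)] mono[OF _ k(2)] mult[of r n] mult[of 1 k] mult[of 1 "Suc k"] \<open>r \<ge> 0\<close>
      by simp_all
    moreover have "real k * m 1 \<le> real n * r * m 1" "real n * r * m 1 \<le> real (Suc k) * m 1"
      using k nonneg[of 1] by (intro mult_right_mono; simp)+
    ultimately show ?thesis by (simp add: algebra_simps abs_le_iff)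
  qed
  show ?thesis
  proof (rule ccontr)
    assume "m r \<noteq> r * m 1"
    then obtain n where "m 1 < real n * \<bar>m r - r * m 1\<bar>"
      using reals_Archimedean3[of "\<bar>m r - r * m 1\<bar>"] by auto
    with bound[of n] show False by (simp add: abs_mult)
  qed
qed

text \<open>Stacking: a prism of height \<open>a + b\<close> consists of one of height
  \<open>a\<close> and a translate of one of height \<open>b\<close>, meeting inside a hyperplane,
  which is a null set. So the volume is additive in the height, hence linear.\<close>

lemma measure_prism_height:
  fixes u :: "real^'n"
  assumes "compact S" "S \<subseteq> orth_hyperplane u" "norm u = 1" "h \<ge> 0"
  shows "measure lebesgue {s + t *\<^sub>R u | s t. s \<in> S \<and> t \<in> {0..h}} =
    h * measure lebesgue {s + t *\<^sub>R u | s t. s \<in> S \<and> t \<in> {0..1}}"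
proof -
  define A where "A h = {s + t *\<^sub>R u | s t. s \<in> S \<and> t \<in> {0..h}}" for h
  have "compact (A h)" for h
  proof -
    have "A h = (\<lambda>(s, t). s + t *\<^sub>R u) ` (S \<times> {0..h})" by (force simp: A_def)
    also have "compact \<dots>"
      using assms(1) by (intro compact_continuous_image compact_Times)
        (auto simp: case_prod_beta intro!: continuous_intros)
    finally show ?thesis .
  qed
  then have meas: "A h \<in> lmeasurable" for h by (rule lmeasurable_compact)
  have inner: "u \<bullet> (s + t *\<^sub>R u) = t" if "s \<in> S" for s t
  proof -
    have "u \<bullet> s = 0" using assms(2) that by (auto simp: orth_hyperplane_def)
    moreover have "u \<bullet> u = 1" using assms(3) by (simp add: norm_eq_1)
    ultimately show ?thesis by (simp add: inner_add_right)
  qed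
  have "measure lebesgue (A (a + b)) = measure lebesgue (A a) + measure lebesgue (A b)"
    if "a \<ge> 0" "b \<ge> 0" for a b
  proof -
    let ?B = "(+) (a *\<^sub>R u) ` A b"
    have "A (a + b) = A a \<union> ?B"
    proof (intro equalityI subsetI)
      fix w assume "w \<in> A (a + b)"
      then obtain s t where w: "w = s + t *\<^sub>R u" "s \<in> S" "0 \<le> t" "t \<le> a + b"
        by (auto simp: A_def)
      show "w \<in> A a \<union> ?B"
      proof (cases "t \<le> a")
        case True
        with w show ?thesis by (auto simp: A_def)
      next
        case False
        have "w = a *\<^sub>R u + (s + (t - a) *\<^sub>R u)" by (simp add: w algebra_simps)
        moreover have "s + (t - a) *\<^sub>R u \<in> A b"
          unfolding A_def using w False by (intro CollectI exI[of _ s] exI[of _ "t - a"]) auto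
        ultimately show ?thesis by blast
      qed
    next
      fix w assume "w \<in> A a \<union> ?B"
      then show "w \<in> A (a + b)"
      proof
        assume "w \<in> A a"
        then obtain s t where "w = s + t *\<^sub>R u" "s \<in> S" "0 \<le> t" "t \<le> a" by (auto simp: A_def)
        with that show ?thesis
          unfolding A_def by (intro CollectI exI[of _ s] exI[of _ t]) auto
      next
        assume "w \<in> ?B"
        then obtain s t where "w = a *\<^sub>R u + (s + t *\<^sub>R u)" "s \<in> S" "0 \<le> t" "t \<le> b"
          by (auto simp: A_def)
        with that show ?thesis
          unfolding A_def by (intro CollectI exI[of _ s] exI[of _ "a + t"]) (auto simp: algebra_simps)
      qed
    qed
    moreover have "measure lebesgue (A a \<inter> ?B) = 0"
    proof -
      have "A a \<inter> ?B \<subseteq> {w. u \<bullet> w = a}"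
      proof
        fix w assume "w \<in> A a \<inter> ?B"
        then obtain s t s' t' where w: "w = s + t *\<^sub>R u" "s \<in> S" "t \<le> a"
          "w = a *\<^sub>R u + (s' + t' *\<^sub>R u)" "s' \<in> S" "0 \<le> t'" by (auto simp: A_def)
        have "u \<bullet> w = t" using w inner by simp
        moreover have "u \<bullet> w = a + t'"
          using inner[OF w(5), of "a + t'"] w(4) by (simp add: algebra_simps)
        ultimately show "w \<in> {w. u \<bullet> w = a}" using w(3,6) by simp
      qed
      moreover have "negligible {w. u \<bullet> w = a}"
        using assms(3) by (intro negligible_hyperplane) auto
      ultimately show ?thesis by (meson negligible_imp_measure0 negligible_subset)
    qed
    moreover have "measure lebesgue ?B = measure lebesgue (A b)" by (rule measure_translation)
    ultimately show ?thesis
      using measure_Un3[OF meas[of a] measurable_translation[OF meas[of b], of "a *\<^sub>R u"]] by simp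
  qed
  from additive_nonneg_imp_linear[where m = "\<lambda>h. measure lebesgue (A h)", OF this _ assms(4)]
  show ?thesis by (simp add: A_def)
qed

lemma prism_eq_halfspaces:
  fixes x :: "real^'n"
  assumes "x \<noteq> 0"
  shows "{s + t *\<^sub>R x | s t. s \<in> {y. \<forall>(a, \<beta>)\<in>C. a \<bullet> y \<le> \<beta>} \<inter> orth_hyperplane x \<and> t \<in> {0..1}} =
    {w. (\<forall>(a, \<beta>)\<in>C. (x \<bullet> x) * (a \<bullet> w) - (x \<bullet> w) * (a \<bullet> x) \<le> \<beta> * (x \<bullet> x)) \<and>
       0 \<le> x \<bullet> w \<and> x \<bullet> w \<le> x \<bullet> x}" (is "?A = ?B")
proof (intro equalityI subsetI)
  have pos: "x \<bullet> x > 0" using assms by simp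
  fix w assume "w \<in> ?A"
  then obtain s t where w: "w = s + t *\<^sub>R x" and s: "\<And>a \<beta>. (a, \<beta>) \<in> C \<Longrightarrow> a \<bullet> s \<le> \<beta>"
    "x \<bullet> s = 0" and t: "0 \<le> t" "t \<le> 1"
    by (clarsimp simp: orth_hyperplane_def) blast
  have xw: "x \<bullet> w = t * (x \<bullet> x)" by (simp add: w inner_add_right s)
  have "(x \<bullet> x) * (a \<bullet> w) - (x \<bullet> w) * (a \<bullet> x) = (a \<bullet> s) * (x \<bullet> x)" for a
    unfolding xw by (simp add: w inner_add_right algebra_simps)
  with s(1) pos t show "w \<in> ?B"
    by (auto simp: xw intro!: mult_right_mono mult_left_le_one_le)
next
  have pos: "x \<bullet> x > 0" using assms by simp
  fix w assume w: "w \<in> ?B"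
  \<comment> \<open>\<open>t\<close> is the height of \<open>w\<close> in units of \<open>x\<close>,
    and \<open>s\<close> is the orthogonal projection of \<open>w\<close> onto the
    hyperplane.\<close>
  define t where "t = (x \<bullet> w) / (x \<bullet> x)"
  define s where "s = w - t *\<^sub>R x"
  have xw: "x \<bullet> w = t * (x \<bullet> x)" using pos by (simp add: t_def)
  have "a \<bullet> s \<le> \<beta>" if "(a, \<beta>) \<in> C" for a \<beta>
  proof -
    have "(a \<bullet> s) * (x \<bullet> x) \<le> \<beta> * (x \<bullet> x)"
      using w that xw by (auto simp: s_def inner_diff_right algebra_simps)
    with pos show ?thesis by simp
  qed
  moreover have "x \<bullet> s = 0" by (simp add: s_def inner_diff_right xw)
  moreover have "0 \<le> t" "t \<le> 1" using w pos by (auto simp: t_def)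
  ultimately show "w \<in> ?A"
    by (intro CollectI exI[of _ s] exI[of _ t]) (auto simp: orth_hyperplane_def s_def)
qed

section \<open>The volume of the prism as a function of its direction\<close>

lemma polyhedron_halfspace_pairs:
  fixes P :: "'a::euclidean_space set"
  assumes "polyhedron P"
  obtains C where "finite C" "P = {y. \<forall>(a, \<beta>)\<in>C. a \<bullet> y \<le> \<beta>}"
proof -
  obtain F where F: "finite F" "P = \<Inter> F" "\<forall>h\<in>F. \<exists>a b. h = {x. a \<bullet> x \<le> b}"
    using assms unfolding polyhedron_def by metis
  then obtain a b where ab: "\<And>h. h \<in> F \<Longrightarrow> h = {x. a h \<bullet> x \<le> b h}" by metis
  have "P = {y. \<forall>(c, \<beta>)\<in>(\<lambda>h. (a h, b h)) ` F. c \<bullet> y \<le> \<beta>}"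
    unfolding F(2) using ab by auto
  with that F(1) show thesis by blast
qed

lemma pwrat_prism_volume:
  fixes P :: "(real^'n) set"
  assumes "polyhedron P" "bounded P"
  obtains V where "pwrat V" "\<And>x. x \<noteq> 0 \<Longrightarrow>
    measure lebesgue {s + t *\<^sub>R x | s t. s \<in> P \<inter> orth_hyperplane x \<and> t \<in> {0..1}} = V x"
proof -
  obtain C where C: "finite C" "P = {y. \<forall>(a, \<beta>)\<in>C. a \<bullet> y \<le> \<beta>}"
    using polyhedron_halfspace_pairs[OF assms(1)] by blast
  obtain B where B: "B > 0" "\<And>s. s \<in> P \<Longrightarrow> norm s \<le> B"
    using assms(2) by (auto simp: bounded_pos)
  \<comment> \<open>The form \<open>v x \<bullet> y - d x\<close> written out in
    \<open>Basis\<close> entries; both normal and offset depend on the parameter.\<close>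
  define lin :: "(real^'n \<Rightarrow> real^'n) \<Rightarrow> (real^'n \<Rightarrow> real) \<Rightarrow> real^'n \<Rightarrow> (real^'n \<Rightarrow> real) \<Rightarrow> real"
    where "lin v d = (\<lambda>x y. (\<Sum>b\<in>Basis. (v x \<bullet> b) * y b) - d x)" for v d
  have lin: "param_affine (lin v d)" if "\<And>b. polyfun (\<lambda>x. v x \<bullet> b)" "polyfun d" for v d
    unfolding lin_def using that
    by (intro param_affine_diff param_affine_sum param_affine.coord param_affine.const pwrat_polyfun)
  have lin_eq: "lin v d x (override_on (\<lambda>_. 0) (\<lambda>b. w \<bullet> b) Basis) = v x \<bullet> w - d x" for v d x w
    unfolding lin_def by (subst euclidean_inner) (simp add: override_on_def)
  \<comment> \<open>Up to the factor \<open>x \<bullet> x\<close> this is the projection of the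
    normal \<open>a\<close> onto the hyperplane of \<open>x\<close>: projection is self-adjoint, so
    it may act on the normal instead of on \<open>w\<close>.\<close>
  define N where "N a x = (x \<bullet> x) *\<^sub>R a - (x \<bullet> a) *\<^sub>R x" for a x :: "real^'n"
  have N_inner: "N a x \<bullet> w = (x \<bullet> x) * (a \<bullet> w) - (x \<bullet> w) * (a \<bullet> x)" for a x w
    by (simp add: N_def inner_diff_left inner_commute[of a x])
  \<comment> \<open>The first two forms bound the height from below and above; the others come from
    the inequalities of \<open>P\<close>.\<close>
  define H where "H = {lin uminus (\<lambda>_. 0), lin (\<lambda>x. x) (\<lambda>x. x \<bullet> x)} \<union>
      (\<lambda>c. lin (N (fst c)) (\<lambda>x. snd c * (x \<bullet> x))) ` C"
  \<comment> \<open>A polynomial bound for \<open>B + norm x\<close>, obtained from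
    \<open>2 * norm x \<le> 1 + x \<bullet> x\<close>.\<close>
  define R where "R x = B + 1 + x \<bullet> x" for x :: "real^'n"
  have "finite H" using C by (simp add: H_def)
  moreover have "param_affine L" if "L \<in> H" for L
  proof -
    have 1: "polyfun (\<lambda>x. - x \<bullet> b)" for b :: "real^'n"
      using polyfun_minus[OF polyfun_inner] by simp
    have 2: "polyfun (\<lambda>x. N a x \<bullet> b)" for a b :: "real^'n"
      using polyfun.add[OF polyfun.mult[OF polyfun_inner_self polyfun.const[of "a \<bullet> b"]]
          polyfun_minus[OF polyfun.mult[OF polyfun_inner[of a] polyfun_inner[of b]]]]
      by (simp add: N_def inner_diff_left)
    have 3: "polyfun (\<lambda>x. \<beta> * (x \<bullet> x))" for \<beta>
      by (rule polyfun.mult[OF polyfun.const polyfun_inner_self])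
    show ?thesis
      using that lin[OF 1 polyfun.const[of 0]] lin[OF polyfun_inner polyfun_inner_self] lin[OF 2 3]
      by (auto simp: H_def)
  qed
  moreover have "pwrat R"
    unfolding R_def by (intro pwrat_polyfun polyfun.add polyfun.const polyfun_inner_self)
  moreover have "R x \<ge> 0" for x using B(1) by (simp add: R_def)
  ultimately obtain V where V: "pwrat V"
    "\<And>x. (\<And>w b. w \<in> {w. \<forall>L\<in>H. L x (override_on (\<lambda>_. 0) (\<lambda>b. w \<bullet> b) Basis) \<le> 0} \<Longrightarrow>
        b \<in> Basis \<Longrightarrow> \<bar>w \<bullet> b\<bar> \<le> R x) \<Longrightarrow>
      measure lebesgue {w. \<forall>L\<in>H. L x (override_on (\<lambda>_. 0) (\<lambda>b. w \<bullet> b) Basis) \<le> 0} = V x"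
    using pwrat_volume_polyhedron[of H R] by blast
  have "measure lebesgue {s + t *\<^sub>R x | s t. s \<in> P \<inter> orth_hyperplane x \<and> t \<in> {0..1}} = V x"
    (is "measure _ ?Q = _") if "x \<noteq> 0" for x
  proof -
    have Q: "{w. \<forall>L\<in>H. L x (override_on (\<lambda>_. 0) (\<lambda>b. w \<bullet> b) Basis) \<le> 0} = ?Q"
      unfolding C(2) prism_eq_halfspaces[OF that] H_def by (auto simp: lin_eq N_inner)
    show ?thesis
    proof (rule V(2)[of x, unfolded Q])
      fix w b :: "real^'n"
      assume "w \<in> ?Q" and b: "b \<in> Basis"
      then obtain s t where w: "w = s + t *\<^sub>R x" "s \<in> P" "0 \<le> t" "t \<le> 1" by auto
      have "norm w \<le> norm s + t * norm x"
        using norm_triangle_ineq[of s "t *\<^sub>R x"] w by simp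
      also have "\<dots> \<le> B + norm x"
        using w B mult_right_mono[of t 1 "norm x"] by (intro add_mono) auto
      also have "\<dots> \<le> R x"
      proof -
        have "2 * norm x \<le> 1 + x \<bullet> x"
          using zero_le_power2[of "norm x - 1"]
          by (simp add: power2_diff power2_norm_eq_inner)
        with norm_ge_zero[of x] show ?thesis unfolding R_def by linarith
      qed
      finally show "\<bar>w \<bullet> b\<bar> \<le> R x"
        using Basis_le_norm[OF b, of w] by simp
    qed
  qed
  with V(1) that show thesis by blast
qed

section \<open>The intersection body of a polytope\<close>

theorem theorem2p6:
  fixes P :: "(real^'n) set"
  assumes "polytope P" and "interior P \<noteq> {}" and "0 \<in> P"
  shows "semialgebraic (intersection_body P)"
proof -
  obtain V where V: "pwrat V" "\<And>x. x \<noteq> 0 \<Longrightarrow>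
    measure lebesgue {s + t *\<^sub>R x | s t. s \<in> P \<inter> orth_hyperplane x \<and> t \<in> {0..1}} = V x"
    using pwrat_prism_volume[OF polytope_imp_polyhedron polytope_imp_bounded] assms(1) by blast
  have radial: "radial_IB P x \<ge> 1 \<longleftrightarrow> V x - x \<bullet> x \<ge> 0" if "x \<noteq> 0" for x
  proof -
    let ?S = "P \<inter> orth_hyperplane x" and ?u = "x /\<^sub>R norm x"
    have pos: "norm x > 0" using that by simp
    have "closed (orth_hyperplane x)"
      unfolding orth_hyperplane_def by (rule closed_hyperplane)
    then have "compact ?S"
      by (intro compact_Int_closed polytope_imp_compact assms(1))
    moreover have "?S \<subseteq> orth_hyperplane ?u" by (auto simp: orth_hyperplane_def)
    ultimately have "measure lebesgue {s + t *\<^sub>R ?u | s t. s \<in> ?S \<and> t \<in> {0..norm x}} =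
        norm x * hyperplane_volume x ?S"
      unfolding hyperplane_volume_def using that by (intro measure_prism_height) auto
    \<comment> \<open>The unit direction with height \<open>norm x\<close> sweeps the same segments
      as \<open>x\<close> with height 1. This trades the normalized prism for one described by
      polynomials in \<open>x\<close>.\<close>
    moreover have "{s + t *\<^sub>R ?u | s t. s \<in> ?S \<and> t \<in> {0..norm x}} =
        {s + t *\<^sub>R x | s t. s \<in> ?S \<and> t \<in> {0..1}}" (is "?A = ?B")
    proof (intro equalityI subsetI)
      fix w assume "w \<in> ?A"
      then obtain s t where "w = s + t *\<^sub>R ?u" "s \<in> ?S" "t \<in> {0..norm x}" by blast
      with pos show "w \<in> ?B"
        by (intro CollectI exI[of _ s] exI[of _ "t / norm x"]) (auto simp: divide_inverse[symmetric])
    next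
      fix w assume "w \<in> ?B"
      then obtain s t where "w = s + t *\<^sub>R x" "s \<in> ?S" "t \<in> {0..1}" by blast
      with pos show "w \<in> ?A"
        by (intro CollectI exI[of _ s] exI[of _ "t * norm x"]) (auto simp: mult_left_le_one_le)
    qed
    ultimately have "V x = norm x * hyperplane_volume x ?S" using V(2)[OF that] by simp
    moreover have "x \<bullet> x = norm x * norm x" by (simp add: dot_square_norm power2_eq_square)
    ultimately show ?thesis
      using pos by (simp add: radial_IB_def)
  qed
  \<comment> \<open>\<open>V\<close> is specified only away from the origin. The second set
    contributes the origin, so it is irrelevant whether the first one contains it.\<close>
  have eq: "intersection_body P = {x. V x + - (x \<bullet> x) \<ge> 0} \<union> {x. x \<bullet> x = 0}"
    using radial by (auto simp: intersection_body_def)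
  show ?thesis
    unfolding eq
    by (rule semialgebraic.union[OF semialgebraic_pwrat_ge[OF pwrat_add[OF V(1)
          pwrat_polyfun[OF polyfun_minus[OF polyfun_inner_self]]]]
          semialgebraic_zero_set[OF polyfun_inner_self]])
qed

end
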